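(* Let $\overline{A}(n)=\sum_{b=2}^n\frac{2}{b-1}S_b(n)\log b$. Then for all integers $n\ge 2$, $$\overline{A}(n)=\left(\frac32-\gamma\right)n^2\log n+\left(\frac32\gamma+\gamma_1-\frac74\right)n^2+O\left(n^{3/2}\log n\right),$$ where $\gamma$ is Euler's constant and $\gamma_1$ is the first Stieltjes constant.
   Context: For integers $b\ge 2$ and $n\ge 1$, $d_b(n)$ denotes the sum of the base-$b$ digits of $n$, and $S_b(n):=\sum_{j=1}^{n-1}d_b(j)$. The first Stieltjes constant is $\gamma_1=\lim_{n\to\infty}\left(\sum_{k=1}^n\frac{\log k}{k}-\frac{(\log n)^2}{2}\right)$. The constant implied by the $O$-notation is absolute. *)

theory Defs
  imports "HOL-Analysis.Analysis"
begin

text \<open>The value for the meaningless bases \<open>b < 2\<close> is set to 0; it is never used.\<close>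

function digit_sum :: "nat \<Rightarrow> nat \<Rightarrow> nat" where
  "digit_sum b n = (if b < 2 \<or> n = 0 then 0 else n mod b + digit_sum b (n div b))"
  by auto
termination
  by (relation "Wellfounded.measure snd") auto

declare digit_sum.simps [simp del]

text \<open>
  The recursion computes the sum of the coefficients of any base-\<open>b\<close> expansion
  (leading zeros allowed).
\<close>

lemma digit_sum_expansion:
  assumes "b \<ge> 2" and "\<And>i. i < k \<Longrightarrow> c i < b"
  shows "digit_sum b (\<Sum>i<k. c i * b ^ i) = (\<Sum>i<k. c i)"
  using assms(2)
proof (induction k arbitrary: c)
  case 0
  show ?case by (simp add: digit_sum.simps)
next
  case (Suc k)
  let ?m = "\<Sum>i<k. c (Suc i) * b ^ i"
  have split: "(\<Sum>i<Suc k. c i * b ^ i) = c 0 + b * ?m"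
    by (simp add: sum.lessThan_Suc_shift sum_distrib_left mult_ac del: sum.lessThan_Suc)
  have "c 0 < b"
    using Suc.prems by blast
  then have "(c 0 + b * ?m) mod b = c 0" "(c 0 + b * ?m) div b = ?m"
    by simp_all
  moreover have "digit_sum b 0 = 0"
    by (simp add: digit_sum.simps)
  ultimately have "digit_sum b (c 0 + b * ?m) = c 0 + digit_sum b ?m"
    using assms(1) by (subst digit_sum.simps) auto
  also have "digit_sum b ?m = (\<Sum>i<k. c (Suc i))"
    using Suc.prems by (intro Suc.IH) auto
  finally show ?case
    unfolding split by (simp add: sum.lessThan_Suc_shift del: sum.lessThan_Suc)
qed

definition S :: "nat \<Rightarrow> nat \<Rightarrow> nat" where
  "S b n = (\<Sum>j = 1..<n. digit_sum b j)"

definition A_bar :: "nat \<Rightarrow> real" where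
  "A_bar n = (\<Sum>b = 2..n. 2 / (real b - 1) * real (S b n) * ln (real b))"

definition stieltjes_1 :: real where
  "stieltjes_1 = lim (\<lambda>n. (\<Sum>k = 1..n. ln (real k) / real k) - (ln (real n))\<^sup>2 / 2)"

end

theory Submission
  imports Defs
begin

text \<open>
  Cut the sum over the bases \<open>b\<close> at \<open>s = \<lfloor>\<surd>n\<rfloor>\<close>. A base \<open>b \<le> s\<close> contributes
  \<open>O(n log n)\<close>, since a number below \<open>n\<close> has at most \<open>1 + log n / log b\<close> digits, each at
  most \<open>b - 1\<close>. For \<open>b > s\<close> every \<open>j < n\<close> has at most two digits, so its digit sum is
  \<open>j - (b - 1) \<lfloor>j / b\<rfloor>\<close>. Counting the pairs \<open>(j, m)\<close> with \<open>m b \<le> j < n\<close> turns the sum of the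
  \<open>\<lfloor>j / b\<rfloor>\<close> into the sum of the positive parts of \<open>n - m b\<close> over \<open>m \<le> s\<close>. Exchanging the sums
  over \<open>b\<close> and \<open>m\<close>, the sum over \<open>b\<close> is a difference of sums of the monotone functions
  \<open>log b\<close> and \<open>b log b\<close>, hence given by integrals up to \<open>O(n log n)\<close>. The remaining sums of
  \<open>1 / m\<close> and \<open>log m / m\<close> over \<open>m \<le> s\<close> produce \<open>\<gamma>\<close> and \<open>\<gamma>\<^sub>1\<close>, and the terms in
  \<open>n\<^sup>2 (log n)\<^sup>2\<close> cancel. All errors are bounded by multiples of \<open>n s log n\<close>.
\<close>

section \<open>Comparison of sums of monotone functions with integrals\<close>

text \<open>By the mean value theorem each increment \<open>F (j + 1) - F j\<close> lies between
  \<open>f j\<close> and \<open>f (j + 1)\<close>, so the errors up to \<open>k\<close> telescope.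
  The upper end \<open>x\<close> may be fractional, since it will be \<open>n / m\<close>; the piece
  from \<open>k\<close> to \<open>x\<close> adds an error of the opposite sign, so
  \<open>f x\<close> alone bounds both.\<close>

lemma sum_minus_primitive_mono:
  fixes f F :: "real \<Rightarrow> real"
  assumes deriv: "\<And>x. x \<ge> 1 \<Longrightarrow> (F has_real_derivative f x) (at x)"
    and mono: "\<And>x y. 1 \<le> x \<Longrightarrow> x \<le> y \<Longrightarrow> f x \<le> f y"
    and nonneg: "\<And>x. 1 \<le> x \<Longrightarrow> 0 \<le> f x"
    and "1 \<le> s" "s \<le> k" "real k \<le> x" "x \<le> real k + 1"
  shows "\<bar>(\<Sum>b = Suc s..k. f (real b)) - (F x - F (real s))\<bar> \<le> f x"
proof -
  have mvt: "\<exists>z. u \<le> z \<and> z \<le> v \<and> F v - F u = (v - u) * f z" if "1 \<le> u" "u \<le> v" for u v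
  proof (cases "u = v")
    case True
    then show ?thesis by auto
  next
    case False
    with that have "u < v" by simp
    from MVT2[OF this, of F f] deriv that show ?thesis
      by (meson less_imp_le order_trans)
  qed
  have "0 \<le> (\<Sum>b = Suc s..k. f (real b)) - (F k - F s) \<and>
      (\<Sum>b = Suc s..k. f (real b)) - (F k - F s) \<le> f k - f s"
    using \<open>s \<le> k\<close>
  proof (induction k rule: dec_induct)
    case base
    then show ?case by simp
  next
    case (step j)
    obtain z where z: "real j \<le> z" "z \<le> real (Suc j)" "F (Suc j) - F j = (real (Suc j) - real j) * f z"
      using mvt[of "real j" "real (Suc j)"] step.hyps \<open>1 \<le> s\<close> by auto
    have "f j \<le> f z" "f z \<le> f (Suc j)"
      using z step.hyps \<open>1 \<le> s\<close> by (auto intro!: mono)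
    with z step show ?case by simp
  qed
  moreover obtain z where z: "real k \<le> z" "z \<le> x" "F x - F k = (x - k) * f z"
    using mvt[of "real k" x] assms by auto
  moreover have "0 \<le> f z" "f z \<le> f x" "f k \<le> f x" "0 \<le> f s"
    using z assms by (auto intro!: mono nonneg)
  moreover have "(x - k) * f z \<le> 1 * f z"
    using \<open>0 \<le> f z\<close> \<open>x \<le> real k + 1\<close> by (intro mult_right_mono) linarith+
  moreover have "0 \<le> (x - k) * f z"
    using \<open>0 \<le> f z\<close> \<open>real k \<le> x\<close> by simp
  ultimately show ?thesis by linarith
qed

text \<open>An interval instead of an absolute value keeps the sign of the error: the difference of
  sum and primitive decreases, which is what the convergence in
  \<open>sum_minus_primitive_limit\<close> rests on.\<close>

lemma sum_minus_primitive_antimono: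
  fixes f F :: "real \<Rightarrow> real"
  assumes deriv: "\<And>x. x \<ge> a \<Longrightarrow> (F has_real_derivative f x) (at x)"
    and antimono: "\<And>x y. a \<le> x \<Longrightarrow> x \<le> y \<Longrightarrow> f y \<le> f x"
    and "a \<le> real k" "k \<le> l"
  shows "(\<Sum>j = Suc k..l. f (real j)) - (F l - F k) \<in> {f l - f k..0}"
  using \<open>k \<le> l\<close>
proof (induction l rule: dec_induct)
  case base
  then show ?case by simp
next
  case (step j)
  have "\<exists>z>real j. z < real (Suc j) \<and> F (Suc j) - F j = (real (Suc j) - real j) * f z"
    using assms(3) step.hyps by (intro MVT2 deriv) auto
  then obtain z where z: "real j < z" "z < real (Suc j)" "F (Suc j) - F j = (real (Suc j) - real j) * f z"
    by blast
  have "f (Suc j) \<le> f z" "f z \<le> f j"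
    using z step.hyps assms(3) by (auto intro!: antimono)
  with z step show ?case by simp
qed

text \<open>The differences \<open>D n\<close> decrease from \<open>k\<close> on and stay above
  \<open>D k - f k\<close>, so they converge. Convergence must be shown because \<open>lim\<close>
  says nothing about a divergent sequence; in particular this justifies the \<open>lim\<close> in
  \<open>stieltjes_1\<close>.\<close>

lemma sum_minus_primitive_limit:
  fixes f F :: "real \<Rightarrow> real"
  assumes deriv: "\<And>x. x \<ge> a \<Longrightarrow> (F has_real_derivative f x) (at x)"
    and antimono: "\<And>x y. a \<le> x \<Longrightarrow> x \<le> y \<Longrightarrow> f y \<le> f x"
    and nonneg: "\<And>x. a \<le> x \<Longrightarrow> 0 \<le> f x"
    and k: "a \<le> real k"
  shows "\<bar>(\<Sum>j = 1..k. f (real j)) - F k - lim (\<lambda>n. (\<Sum>j = 1..n. f (real j)) - F n)\<bar> \<le> f k"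
proof -
  define D where "D n = (\<Sum>j = 1..n. f (real j)) - F n" for n :: nat
  have D_diff: "D l - D k \<in> {f l - f k..0}" if "a \<le> real k" "k \<le> l" for k l
  proof -
    have "(\<Sum>j = 1..l. f (real j)) = (\<Sum>j = 1..k. f (real j)) + (\<Sum>j = Suc k..l. f (real j))"
      using \<open>k \<le> l\<close> sum.ub_add_nat[of 1 k "\<lambda>j. f (real j)" "l - k"] by simp
    then show ?thesis
      using sum_minus_primitive_antimono[of a F f k l, OF deriv antimono] that by (auto simp: D_def)
  qed
  \<comment> \<open>The shift by \<open>k\<close> skips the initial terms, where \<open>f\<close>
    need not decrease.\<close>
  have "decseq (\<lambda>n. D (n + k))"
  proof (rule decseq_SucI)
    fix n show "D (Suc n + k) \<le> D (n + k)"
      using D_diff[of "n + k" "Suc n + k"] k by simp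
  qed
  moreover have "D k - f k \<le> D (n + k)" for n
    using D_diff[of k "n + k"] nonneg[of "real (n + k)"] k by simp
  ultimately have "convergent (\<lambda>n. D (n + k))"
    using decseq_convergent by (metis convergent_def)
  then have "convergent D"
    by (simp add: convergent_ignore_initial_segment)
  then have lim: "D \<longlonglongrightarrow> lim D"
    by (simp add: convergent_LIMSEQ_iff)
  have "D l \<le> D k \<and> D k - f k \<le> D l" if "k \<le> l" for l
    using D_diff[OF k that] nonneg[of l] k that by simp
  then have "lim D \<le> D k \<and> D k - f k \<le> lim D"
    using lim by (meson LIMSEQ_le_const2 LIMSEQ_le_const)
  then show "\<bar>(\<Sum>j = 1..k. f (real j)) - F k - lim (\<lambda>n. (\<Sum>j = 1..n. f (real j)) - F n)\<bar> \<le> f k"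
    using nonneg[OF k] by (simp add: D_def[abs_def])
qed

section \<open>Euler's constant and the first Stieltjes constant\<close>

lemma harm_approx:
  assumes "1 \<le> k"
  shows "\<bar>(\<Sum>j = 1..k. 1 / real j) - ln k - euler_mascheroni\<bar> \<le> 1 / real k"
proof -
  have "lim (\<lambda>n. (\<Sum>j = 1..n. 1 / real j) - ln n) = euler_mascheroni"
    using euler_mascheroni_LIMSEQ
    by (intro limI) (simp add: harm_def inverse_eq_divide)
  moreover have "\<bar>(\<Sum>j = 1..k. 1 / real j) - ln k - lim (\<lambda>n. (\<Sum>j = 1..n. 1 / real j) - ln n)\<bar> \<le> 1 / real k"
    using assms
    by (intro sum_minus_primitive_limit[of 1 ln "\<lambda>x. 1 / x"])
       (auto intro!: derivative_eq_intros simp: field_simps)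
  ultimately show ?thesis by simp
qed

text \<open>The derivative \<open>(1 - ln t) / t\<^sup>2\<close> is nonpositive once
  \<open>t\<close> reaches \<open>exp 1\<close>, and 3 is the first integer beyond that point. The
  recurring condition that \<open>s\<close> is at least 3 comes from here.\<close>

lemma ln_over_self_antimono:
  fixes x y :: real
  assumes "3 \<le> x" "x \<le> y"
  shows "ln y / y \<le> ln x / x"
proof (rule DERIV_nonpos_imp_nonincreasing[OF \<open>x \<le> y\<close>])
  fix t :: real
  assume "x \<le> t" "t \<le> y"
  then have t: "exp 1 \<le> t"
    using exp_le assms by linarith
  then have "t > 0" "1 \<le> ln t"
    using \<open>x \<le> t\<close> assms by (auto simp: ln_ge_iff)
  then have "((\<lambda>x. ln x / x) has_real_derivative (1 - ln t) / t\<^sup>2) (at t)" "(1 - ln t) / t\<^sup>2 \<le> 0"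
    by (auto intro!: derivative_eq_intros divide_nonpos_nonneg simp: power2_eq_square)
  then show "\<exists>d. ((\<lambda>x. ln x / x) has_real_derivative d) (at t) \<and> d \<le> 0"
    by blast
qed

lemma DERIV_half_ln_squared:
  fixes x :: real
  assumes "x > 0"
  shows "((\<lambda>x. (ln x)\<^sup>2 / 2) has_real_derivative ln x / x) (at x)"
  using assms by (auto intro!: derivative_eq_intros)

lemma sum_ln_over_self_approx:
  assumes "3 \<le> k"
  shows "\<bar>(\<Sum>j = 1..k. ln (real j) / real j) - (ln k)\<^sup>2 / 2 - stieltjes_1\<bar> \<le> ln k / k"
  unfolding stieltjes_1_def using assms
  by (intro sum_minus_primitive_limit[of 3 "\<lambda>x. (ln x)\<^sup>2 / 2" "\<lambda>x. ln x / x"])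
     (auto intro: DERIV_half_ln_squared ln_over_self_antimono)

section \<open>Digit sums in small and in large bases\<close>

text \<open>Dividing by \<open>b\<close> takes one digit, at most \<open>b - 1\<close>, off the
  digit sum and at least \<open>ln b\<close> off \<open>ln j\<close>. The extra \<open>ln b\<close>
  on the right pays for the leading digit.\<close>

lemma digit_sum_le:
  assumes "b \<ge> 2" "j \<ge> 1"
  shows "real (digit_sum b j) * ln b \<le> (real b - 1) * (ln j + ln b)"
  using assms(2)
proof (induction j rule: less_induct)
  case (less j)
  have b: "ln (real b) > 0" "real b - 1 > 0"
    using assms by simp_all
  have "j mod b \<le> b - 1"
    using assms by (metis Suc_pred' less_Suc_eq_le less_le_trans mod_less_divisor pos2)
  then have mod_le: "real (j mod b) * ln b \<le> (real b - 1) * ln b"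
    using b assms by (intro mult_right_mono) linarith+
  have rec: "digit_sum b j = j mod b + digit_sum b (j div b)"
    using assms less.prems by (subst digit_sum.simps) auto
  show ?case
  proof (cases "j < b")
    case True
    then have "digit_sum b j = j mod b"
      using rec by (simp add: digit_sum.simps)
    moreover have "0 \<le> (real b - 1) * ln j"
      using b less.prems by (intro mult_nonneg_nonneg) auto
    ultimately show ?thesis
      using mod_le by (simp only: distrib_left)
  next
    case False
    then have q: "j div b \<ge> 1"
      using assms by (simp add: div_greater_zero_iff Suc_le_eq)
    have "0 < real (j div b * b)"
      using q assms by simp
    moreover have "real (j div b * b) \<le> real j"
      using div_times_less_eq_dividend[of j b] by (simp only: of_nat_le_iff)
    ultimately have "ln (real (j div b * b)) \<le> ln j"
      by (intro ln_mono)
    then have le: "ln (real (j div b)) + ln b \<le> ln j"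
      using q assms by (simp add: ln_mult)
    have "real (digit_sum b (j div b)) * ln b \<le> (real b - 1) * (ln (j div b) + ln b)"
      using assms less.prems q by (intro less.IH) auto
    also have "\<dots> \<le> (real b - 1) * ln j"
      using le b by (intro mult_left_mono) auto
    finally show ?thesis
      using mod_le b rec by (simp add: algebra_simps)
  qed
qed

text \<open>The digits are \<open>j mod b\<close> and \<open>j div b\<close>, the latter possibly 0,
  and \<open>j mod b\<close> is \<open>j - b * (j div b)\<close>.\<close>

lemma digit_sum_two_digits:
  assumes "b \<ge> 2" "j < b * b"
  shows "real (digit_sum b j) = real j - (real b - 1) * real (j div b)"
proof -
  have "j div b < b"
    using assms by (simp add: less_mult_imp_div_less)
  then have q: "digit_sum b (j div b) = j div b"
    using assms by (subst digit_sum.simps) (auto simp: digit_sum.simps[of b 0])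
  have "digit_sum b j = j mod b + j div b"
    using assms q by (subst digit_sum.simps) (auto simp: digit_sum.simps[of b 0])
  moreover have "real j = real (b * (j div b) + j mod b)"
    by simp
  ultimately show ?thesis
    by (simp only: of_nat_add of_nat_mult) (simp add: algebra_simps)
qed

text \<open>Natural subtraction supplies the positive part. Raising \<open>n\<close> by one adds
  \<open>n div b\<close> on the left; on the right exactly the terms with
  \<open>m * b \<le> n\<close> grow by one, and there are \<open>n div b\<close> of them because the
  hypothesis gives \<open>n div b \<le> s\<close>.\<close>

lemma sum_div_eq_sum_minus:
  fixes b n s :: nat
  assumes "b \<ge> 1" "n \<le> (s + 1) * b"
  shows "(\<Sum>j<n. j div b) = (\<Sum>m = 1..s. n - m * b)"
  using assms(2)
proof (induction n)
  case 0
  then show ?case by simp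
next
  case (Suc n)
  have "n div b \<le> s"
    using Suc.prems assms by (metis Suc_eq_plus1 Suc_le_lessD less_Suc_eq_le less_mult_imp_div_less)
  then have "{m \<in> {1..s}. m * b \<le> n} = {1..n div b}"
    using assms(1) by (auto simp flip: less_eq_div_iff_mult_less_eq)
  then have "n div b = (\<Sum>m = 1..s. if m * b \<le> n then 1 else 0)"
    by (simp flip: sum.inter_filter)
  moreover have "(\<Sum>m = 1..s. Suc n - m * b) = (\<Sum>m = 1..s. (n - m * b) + (if m * b \<le> n then 1 else 0))"
    by (intro sum.cong) auto
  ultimately show ?case
    using Suc by (simp add: sum.distrib)
qed

lemma S_eq_two_digits:
  assumes "b \<ge> 2" "n \<le> b * b" "n \<le> (s + 1) * b" "n \<ge> 1"
  shows "real (S b n) = real n * (real n - 1) / 2 - (real b - 1) * (\<Sum>m = 1..s. real (n - m * b))"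
proof -
  \<comment> \<open>The added term \<open>j = 0\<close> has digit sum 0.\<close>
  have "S b n = (\<Sum>j<n. digit_sum b j)"
    unfolding S_def using assms(4)
    by (intro sum.mono_neutral_left) (auto simp: digit_sum.simps[of b 0] not_le)
  then have "real (S b n) = (\<Sum>j<n. real j - (real b - 1) * real (j div b))"
    using assms by (simp add: digit_sum_two_digits)
  also have "\<dots> = (\<Sum>j<n. real j) - (real b - 1) * real (\<Sum>j<n. j div b)"
    by (simp add: sum_subtractf sum_distrib_left)
  also have "(\<Sum>j<n. real j) = real n * (real n - 1) / 2"
    by (induction n) (auto simp: field_simps)
  also have "(\<Sum>j<n. j div b) = (\<Sum>m = 1..s. n - m * b)"
    using assms by (intro sum_div_eq_sum_minus) auto
  finally show ?thesis by simp
qed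

text \<open>Both logarithms in \<open>digit_sum_le\<close> are at most \<open>ln n\<close>, and the
  factor \<open>b - 1\<close> there cancels the denominator of the weight.\<close>

lemma S_small_base_le:
  assumes "b \<ge> 2" "b \<le> n"
  shows "2 / (real b - 1) * real (S b n) * ln b \<le> 4 * real n * ln n"
    and "0 \<le> 2 / (real b - 1) * real (S b n) * ln b"
proof -
  have b: "ln (real b) > 0" "real b - 1 > 0" "ln (real b) \<le> ln n"
    using assms by simp_all
  have "real (S b n) * ln b = (\<Sum>j = 1..<n. real (digit_sum b j) * ln b)"
    by (simp add: S_def sum_distrib_right)
  also have "\<dots> \<le> (\<Sum>j = 1..<n. (real b - 1) * (2 * ln n))"
  proof (intro sum_mono)
    fix j assume j: "j \<in> {1..<n}"
    then have "real (digit_sum b j) * ln b \<le> (real b - 1) * (ln j + ln b)"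
      using assms by (intro digit_sum_le) auto
    also have "\<dots> \<le> (real b - 1) * (2 * ln n)"
    proof (rule mult_left_mono)
      have "ln (real j) \<le> ln n"
        using j by simp
      then show "ln (real j) + ln (real b) \<le> 2 * ln n"
        using b by linarith
    qed (use b in linarith)
    finally show "real (digit_sum b j) * ln b \<le> (real b - 1) * (2 * ln n)" .
  qed
  also have "\<dots> = (real b - 1) * (2 * ln n) * real (n - 1)"
    by simp
  also have "\<dots> \<le> (real b - 1) * (2 * ln n) * real n"
    using b by (intro mult_left_mono mult_nonneg_nonneg) linarith+
  finally have *: "real (S b n) * ln b \<le> (real b - 1) * (2 * ln n) * real n" .
  have "2 / (real b - 1) * real (S b n) * ln b = 2 / (real b - 1) * (real (S b n) * ln b)"
    by simp
  also have "\<dots> \<le> 2 / (real b - 1) * ((real b - 1) * (2 * ln n) * real n)"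
    using * b by (intro mult_left_mono) auto
  also have "\<dots> = 4 * real n * ln n"
    using b by simp
  finally show "2 / (real b - 1) * real (S b n) * ln b \<le> 4 * real n * ln n" .
  show "0 \<le> 2 / (real b - 1) * real (S b n) * ln b"
    using b by simp
qed

section \<open>The double sum over \<open>b\<close> and \<open>m\<close>\<close>

text \<open>The sum is \<open>n\<close> times that of \<open>ln b\<close> minus \<open>m\<close>
  times that of \<open>b * ln b\<close>. Their errors \<open>n * ln x\<close> and
  \<open>m * (x * ln x)\<close> coincide because \<open>m * x = n\<close>.\<close>

lemma sum_ln_times_linear_approx:
  assumes "1 \<le> s" "1 \<le> m" "s \<le> n div m"
  defines "x \<equiv> real n / real m"
  shows "\<bar>(\<Sum>b = Suc s..n div m. ln (real b) * (real n - real m * real b))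
      - (real n * ((x * ln x - x) - (real s * ln s - real s))
         - real m * ((x\<^sup>2 * ln x / 2 - x\<^sup>2 / 4) - ((real s)\<^sup>2 * ln s / 2 - (real s)\<^sup>2 / 4)))\<bar>
    \<le> 2 * real n * ln n"
proof -
  let ?k = "n div m"
  let ?P = "\<Sum>b = Suc s..?k. ln (real b)" and ?Q = "\<Sum>b = Suc s..?k. real b * ln (real b)"
  let ?G = "(x * ln x - x) - (real s * ln s - real s)"
  let ?K = "(x\<^sup>2 * ln x / 2 - x\<^sup>2 / 4) - ((real s)\<^sup>2 * ln s / 2 - (real s)\<^sup>2 / 4)"
  have k: "real ?k \<le> x" "x \<le> real ?k + 1"
  proof -
    have "real_of_int \<lfloor>x\<rfloor> = real ?k"
      by (simp add: x_def floor_divide_of_nat_eq)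
    then show "real ?k \<le> x" "x \<le> real ?k + 1"
      by linarith+
  qed
  have "1 \<le> real ?k"
    using assms by simp
  with k(1) have "1 \<le> x"
    by linarith
  moreover have "x \<le> real n / 1"
    unfolding x_def using assms by (intro divide_left_mono) auto
  ultimately have x: "1 \<le> x" "x \<le> n"
    by simp_all
  have mx: "real m * x = real n"
    using assms by (simp add: x_def)
  have P: "\<bar>?P - ?G\<bar> \<le> ln x"
    using assms k
    by (intro sum_minus_primitive_mono[where f = ln and F = "\<lambda>x. x * ln x - x"])
       (auto intro!: derivative_eq_intros)
  have Q: "\<bar>?Q - ?K\<bar> \<le> x * ln x"
    using assms k
    by (intro sum_minus_primitive_mono[where f = "\<lambda>x. x * ln x" and F = "\<lambda>x. x\<^sup>2 * ln x / 2 - x\<^sup>2 / 4"])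
       (auto intro!: derivative_eq_intros mult_mono simp: field_simps power2_eq_square)
  have "(\<Sum>b = Suc s..?k. ln (real b) * (real n - real m * real b)) = real n * ?P - real m * ?Q"
    by (simp add: sum_distrib_left sum_subtractf[symmetric] algebra_simps)
  then have "\<bar>(\<Sum>b = Suc s..?k. ln (real b) * (real n - real m * real b)) - (real n * ?G - real m * ?K)\<bar>
      = \<bar>real n * (?P - ?G) - real m * (?Q - ?K)\<bar>"
    by (simp only: right_diff_distrib)
  also have "\<dots> \<le> \<bar>real n * (?P - ?G)\<bar> + \<bar>real m * (?Q - ?K)\<bar>"
    by (rule abs_triangle_ineq4)
  also have "\<dots> = real n * \<bar>?P - ?G\<bar> + real m * \<bar>?Q - ?K\<bar>"
    by (simp add: abs_mult)
  also have "\<dots> \<le> real n * ln x + real m * (x * ln x)"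
    using P Q by (intro add_mono mult_left_mono) auto
  also have "\<dots> = 2 * real n * ln x"
    using mx by (metis mult.assoc mult_2 distrib_right)
  also have "\<dots> \<le> 2 * real n * ln n"
    using x by (intro mult_left_mono) auto
  finally show ?thesis .
qed

text \<open>For fixed \<open>m\<close> the truncated difference \<open>n - m * b\<close> vanishes
  when \<open>b > n div m\<close>; below that bound it is the true difference.\<close>

lemma sum_ln_double_sum_swap:
  assumes "1 \<le> s"
  shows "(\<Sum>b = Suc s..n. ln (real b) * (\<Sum>m = 1..s. real (n - m * b)))
    = (\<Sum>m = 1..s. \<Sum>b = Suc s..n div m. ln (real b) * (real n - real m * real b))"
proof -
  have "(\<Sum>b = Suc s..n. ln (real b) * real (n - m * b))
      = (\<Sum>b = Suc s..n div m. ln (real b) * (real n - real m * real b))" if "m \<in> {1..s}" for m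
  proof (rule sum.mono_neutral_cong_right)
    have "n div m \<le> n"
      by simp
    then show "{Suc s..n div m} \<subseteq> {Suc s..n}"
      by (auto intro: le_trans)
    show "\<forall>b\<in>{Suc s..n} - {Suc s..n div m}. ln (real b) * real (n - m * b) = 0"
      using that by (auto simp: less_eq_div_iff_mult_less_eq mult.commute not_le)
    show "ln (real b) * real (n - m * b) = ln (real b) * (real n - real m * real b)"
      if "b \<in> {Suc s..n div m}" for b
    proof -
      have "m * b \<le> n"
        using that \<open>m \<in> {1..s}\<close> by (auto simp: less_eq_div_iff_mult_less_eq mult.commute)
      then show ?thesis
        by (simp add: of_nat_diff)
    qed
  qed auto
  then have "(\<Sum>m = 1..s. \<Sum>b = Suc s..n. ln (real b) * real (n - m * b))
      = (\<Sum>m = 1..s. \<Sum>b = Suc s..n div m. ln (real b) * (real n - real m * real b))"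
    by (rule sum.cong[OF refl])
  then show ?thesis
    by (subst (asm) sum.swap) (simp add: sum_distrib_left)
qed

lemma sum_ln_double_sum_approx:
  assumes "3 \<le> s" "s * s \<le> n"
  defines "N \<equiv> ln (real n)" and "L \<equiv> ln (real s)"
  shows "\<bar>(\<Sum>b = Suc s..n. ln (real b) * (\<Sum>m = 1..s. real (n - m * b)))
      - ((real n)\<^sup>2 * ((N / 2 - 3 / 4) * (\<Sum>m = 1..s. 1 / real m) - (\<Sum>m = 1..s. ln (real m) / real m) / 2)
         - real n * (real s)\<^sup>2 * (L - 1) + real s ^ 3 * (real s + 1) * (L / 4 - 1 / 8))\<bar>
    \<le> 2 * real n * real s * N"
proof -
  \<comment> \<open>\<open>T m\<close> is the main term of \<open>sum_ln_times_linear_approx\<close>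
    at \<open>x = n / m\<close>. Writing \<open>ln (n / m)\<close> as \<open>N - ln m\<close>
    separates the sums of \<open>1 / m\<close> and \<open>ln m / m\<close>.\<close>
  define T where "T m = real n * ((real n / real m * ln (real n / real m) - real n / real m) - (real s * L - real s))
         - real m * (((real n / real m)\<^sup>2 * ln (real n / real m) / 2 - (real n / real m)\<^sup>2 / 4)
            - ((real s)\<^sup>2 * L / 2 - (real s)\<^sup>2 / 4))" for m :: nat
  have n: "real n > 0"
    using assms by (cases n) auto
  have T: "T m = (real n)\<^sup>2 * ((N / 2 - 3 / 4) * (1 / real m) - (ln (real m) / real m) / 2)
      - real n * real s * (L - 1) + real m * ((real s)\<^sup>2 * (L / 2 - 1 / 4))" if "m \<in> {1..s}" for m
  proof -
    have "ln (real n / real m) = N - ln m"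
      using that n by (simp add: N_def ln_div)
    moreover have "real m > 0"
      using that by simp
    ultimately show ?thesis
      by (simp add: T_def) (simp add: field_simps power2_eq_square)
  qed
  have gauss: "(\<Sum>m = 1..s. real m) = real s * (real s + 1) / 2"
    by (induction s) (auto simp: field_simps)
  have "(\<Sum>m = 1..s. T m) = (\<Sum>m = 1..s. (real n)\<^sup>2 * ((N / 2 - 3 / 4) * (1 / real m) - (ln (real m) / real m) / 2)
      - real n * real s * (L - 1) + real m * ((real s)\<^sup>2 * (L / 2 - 1 / 4)))"
    using T by (intro sum.cong) auto
  also have "\<dots> = (real n)\<^sup>2 * ((N / 2 - 3 / 4) * (\<Sum>m = 1..s. 1 / real m) - (\<Sum>m = 1..s. ln (real m) / real m) / 2)
         - real s * (real n * real s * (L - 1)) + (\<Sum>m = 1..s. real m) * ((real s)\<^sup>2 * (L / 2 - 1 / 4))"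
    by (simp only: sum.distrib sum_subtractf sum_distrib_left[symmetric] sum_distrib_right[symmetric]
        sum_divide_distrib[symmetric] sum_constant card_atLeastAtMost)
       (simp; simp add: right_diff_distrib)
  also have "\<dots> = (real n)\<^sup>2 * ((N / 2 - 3 / 4) * (\<Sum>m = 1..s. 1 / real m) - (\<Sum>m = 1..s. ln (real m) / real m) / 2)
         - real n * (real s)\<^sup>2 * (L - 1) + real s ^ 3 * (real s + 1) * (L / 4 - 1 / 8)"
  proof -
    have "real s * (real n * real s * (L - 1)) = real n * (real s)\<^sup>2 * (L - 1)"
      by (simp add: power2_eq_square)
    moreover have "real s * (real s + 1) / 2 * ((real s)\<^sup>2 * (L / 2 - 1 / 4))
        = real s ^ 3 * (real s + 1) * (L / 4 - 1 / 8)"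
      by (simp add: field_simps power2_eq_square power3_eq_cube)
    ultimately show ?thesis
      by (simp only: gauss)
  qed
  finally have sumT: "(\<Sum>m = 1..s. T m) = \<dots>" .
  let ?B = "\<lambda>m. \<Sum>b = Suc s..n div m. ln (real b) * (real n - real m * real b)"
  have "\<bar>(\<Sum>m = 1..s. ?B m) - (\<Sum>m = 1..s. T m)\<bar> \<le> (\<Sum>m = 1..s. \<bar>?B m - T m\<bar>)"
    unfolding sum_subtractf[symmetric] by (rule sum_abs)
  also have "\<dots> \<le> (\<Sum>m = 1..s. 2 * real n * N)"
  proof (rule sum_mono)
    fix m assume m: "m \<in> {1..s}"
    \<comment> \<open>Since \<open>s * s \<le> n\<close>, the inner range starts no later than its
      end for every \<open>m\<close> up to \<open>s\<close>, so the integral estimate applies to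
      each.\<close>
    then have "s * m \<le> n"
      using assms(2) by (meson atLeastAtMost_iff le_trans mult_le_mono2)
    then have "s \<le> n div m"
      using m by (simp add: less_eq_div_iff_mult_less_eq)
    then show "\<bar>?B m - T m\<bar> \<le> 2 * real n * N"
      unfolding T_def N_def L_def using m assms(1)
      by (intro sum_ln_times_linear_approx) auto
  qed
  also have "\<dots> = 2 * real n * real s * N"
    by simp
  finally show ?thesis
    using assms(1) by (simp only: sumT sum_ln_double_sum_swap)
qed

text \<open>Replacing \<open>b - 1\<close> by \<open>b\<close> leaves the primitive
  \<open>(ln x)\<^sup>2 / 2\<close> and costs \<open>ln b / (b * (b - 1))\<close>, whose sum is at
  most \<open>ln n / s\<close> by telescoping \<open>1 / (b - 1) - 1 / b\<close>.\<close>

lemma sum_ln_over_pred_approx: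
  assumes "3 \<le> s" "s \<le> n"
  shows "\<bar>(\<Sum>b = Suc s..n. ln (real b) / (real b - 1)) - ((ln (real n))\<^sup>2 - (ln (real s))\<^sup>2) / 2\<bar>
    \<le> 2 * ln (real n) / real s"
proof -
  let ?R = "\<Sum>b = Suc s..n. ln (real b) / (real b * (real b - 1))"
  have "ln (real b) / (real b - 1) = ln (real b) / real b + ln (real b) / (real b * (real b - 1))"
    if "b \<in> {Suc s..n}" for b
    using that assms by (simp add: field_simps)
  then have split: "(\<Sum>b = Suc s..n. ln (real b) / (real b - 1)) = (\<Sum>b = Suc s..n. ln (real b) / real b) + ?R"
    by (simp flip: sum.distrib)
  have "(\<Sum>b = Suc s..n. ln (real b) / real b) - ((ln (real n))\<^sup>2 / 2 - (ln (real s))\<^sup>2 / 2)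
      \<in> {ln (real n) / real n - ln (real s) / real s..0}"
    using assms
    by (intro sum_minus_primitive_antimono[of 3 "\<lambda>x. (ln x)\<^sup>2 / 2" "\<lambda>x. ln x / x"])
       (auto intro: DERIV_half_ln_squared ln_over_self_antimono)
  moreover have "0 \<le> ln (real n) / real n" "ln (real s) / real s \<le> ln (real n) / real s"
    using assms by (auto intro!: divide_right_mono)
  moreover have "0 \<le> ?R"
    using assms by (intro sum_nonneg) auto
  moreover have "?R \<le> ln (real n) / real s"
  proof -
    have "?R \<le> (\<Sum>b = Suc s..n. ln (real n) * (1 / real (b - 1) - 1 / real b))"
    proof (rule sum_mono)
      fix b assume b: "b \<in> {Suc s..n}"
      then have "ln (real b) / (real b * (real b - 1)) \<le> ln (real n) / (real b * (real b - 1))"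
        using assms by (intro divide_right_mono) auto
      also have "\<dots> = ln (real n) * (1 / real (b - 1) - 1 / real b)"
        using b assms by (simp add: field_simps of_nat_diff)
      finally show "ln (real b) / (real b * (real b - 1)) \<le> \<dots>" .
    qed
    also have "\<dots> = ln (real n) * (1 / real s - 1 / real n)"
    proof -
      have "(\<Sum>b = Suc s..n. 1 / real (b - 1) - 1 / real b) = 1 / real s - 1 / real n"
        using assms(2) by (induction n rule: dec_induct) auto
      then show ?thesis
        by (simp only: sum_distrib_left[symmetric])
    qed
    also have "\<dots> \<le> ln (real n) * (1 / real s)"
      using assms by (intro mult_left_mono) auto
    finally show ?thesis by simp
  qed
  ultimately show ?thesis
    unfolding split by (auto simp: diff_divide_distrib)
qed

section \<open>Assembly of the main terms and errors\<close>

text \<open>Every \<open>b > s\<close> satisfies \<open>n \<le> (s + 1) * b \<le> b * b\<close>, so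
  \<open>S_eq_two_digits\<close> holds with the same range of \<open>m\<close> for all large bases,
  which makes the later exchange of sums possible.\<close>

lemma A_bar_split:
  assumes "3 \<le> s" "s * s \<le> n" "n \<le> (s + 1) * (s + 1)"
  shows "A_bar n = (\<Sum>b = 2..s. 2 / (real b - 1) * real (S b n) * ln (real b))
    + (real n * (real n - 1) * (\<Sum>b = Suc s..n. ln (real b) / (real b - 1))
       - 2 * (\<Sum>b = Suc s..n. ln (real b) * (\<Sum>m = 1..s. real (n - m * b))))"
proof -
  have "2 / (real b - 1) * real (S b n) * ln (real b)
      = real n * (real n - 1) * (ln (real b) / (real b - 1)) - 2 * (ln (real b) * (\<Sum>m = 1..s. real (n - m * b)))"
    if b: "b \<in> {Suc s..n}" for b
  proof -
    have "(s + 1) * (s + 1) \<le> (s + 1) * b" "(s + 1) * b \<le> b * b"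
      using b by (intro mult_le_mono; simp)+
    then have S_eq: "real (S b n) = real n * (real n - 1) / 2 - (real b - 1) * (\<Sum>m = 1..s. real (n - m * b))"
      using b assms by (intro S_eq_two_digits; simp)
    have "real b - 1 > 0"
      using b assms by simp
    then show ?thesis
      unfolding S_eq by (simp add: field_simps)
  qed
  then have "(\<Sum>b = Suc s..n. 2 / (real b - 1) * real (S b n) * ln (real b))
      = real n * (real n - 1) * (\<Sum>b = Suc s..n. ln (real b) / (real b - 1))
       - 2 * (\<Sum>b = Suc s..n. ln (real b) * (\<Sum>m = 1..s. real (n - m * b)))"
    by (simp add: sum_subtractf sum_distrib_left)
  moreover have "s \<le> n"
    using assms(2) le_square le_trans by blast
  then have "A_bar n = (\<Sum>b = 2..s. 2 / (real b - 1) * real (S b n) * ln (real b))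
      + (\<Sum>b = Suc s..n. 2 / (real b - 1) * real (S b n) * ln (real b))"
    unfolding A_bar_def using assms(1)
      sum.ub_add_nat[of 2 s "\<lambda>b. 2 / (real b - 1) * real (S b n) * ln (real b)" "n - s"] by simp
  ultimately show ?thesis by simp
qed

text \<open>Each sum is written as main term plus error, which gives an exact identity with nine
  remainders, each bounded by a multiple of \<open>U\<close>.\<close>

lemma A_bar_approx:
  assumes s: "3 \<le> s" "s * s \<le> n" "n < (s + 1) * (s + 1)"
  shows "\<bar>A_bar n - ((3 / 2 - euler_mascheroni) * (real n)\<^sup>2 * ln (real n)
        + (3 / 2 * euler_mascheroni + stieltjes_1 - 7 / 4) * (real n)\<^sup>2)\<bar>
      \<le> 34 * (real n * real s * ln (real n))"
proof -
  define N L where "N = ln (real n)" and "L = ln (real s)"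
  define t where "t = real n - (real s)\<^sup>2"
  define A1 where "A1 = (\<Sum>b = 2..s. 2 / (real b - 1) * real (S b n) * ln (real b))"
  define D where "D = (\<Sum>b = Suc s..n. ln (real b) * (\<Sum>m = 1..s. real (n - m * b)))"
  define R where "R = (\<Sum>b = Suc s..n. ln (real b) / (real b - 1))"
  define H W where "H = (\<Sum>m = 1..s. 1 / real m)" and "W = (\<Sum>m = 1..s. ln (real m) / real m)"
  define e1 e2 e3 where "e1 = H - L - euler_mascheroni" and "e2 = W - L\<^sup>2 / 2 - stieltjes_1"
    and "e3 = R - (N\<^sup>2 - L\<^sup>2) / 2"
  define e4 where "e4 = D - ((real n)\<^sup>2 * ((N / 2 - 3 / 4) * H - W / 2)
         - real n * (real s)\<^sup>2 * (L - 1) + real s ^ 3 * (real s + 1) * (L / 4 - 1 / 8))"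
  define U where "U = real n * real s * N"

  have s0: "real s \<ge> 3"
    using s(1) by simp
  have "s \<le> n"
    using s(2) le_square le_trans by blast
  have n0: "real n \<ge> 3" "real s \<le> real n"
    using s(1) \<open>s \<le> n\<close> by simp_all
  have t: "0 \<le> t" "t \<le> 2 * real s"
  proof -
    have "n \<le> s * s + 2 * s"
      using s(3) by simp
    then have "real n \<le> real (s * s + 2 * s)" "real (s * s) \<le> real n"
      using s(2) by (simp_all only: of_nat_le_iff)
    then show "0 \<le> t" "t \<le> 2 * real s"
      by (simp_all add: t_def power2_eq_square)
  qed
  have n_eq: "real n = (real s)\<^sup>2 + t"
    by (simp add: t_def)
  have n_le: "real n \<le> 2 * real s * real s"
  proof -
    have "2 * real s \<le> real s * real s"
      using s0 by (intro mult_right_mono) auto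
    with t n_eq show ?thesis by (simp add: power2_eq_square)
  qed
  have L: "1 \<le> L"
    using s0 exp_le unfolding L_def by (subst ln_ge_iff) linarith+
  have LN: "L \<le> N"
    unfolding L_def N_def using s0 n0 by (intro ln_mono) linarith+
  have N: "1 \<le> N"
    using L LN by linarith
  have N_le: "N \<le> 2 * real s"
  proof -
    have "N \<le> ln ((real s + 1)\<^sup>2)"
      unfolding N_def using n0 s0 t n_eq by (intro ln_mono) (auto simp: power2_eq_square algebra_simps)
    also have "\<dots> = 2 * ln (1 + real s)"
      using s0 by (simp add: ln_realpow add.commute)
    also have "\<dots> \<le> 2 * real s"
      using s0 ln_add_one_self_le_self[of "real s"] by simp
    finally show ?thesis .
  qed
  \<comment> \<open>\<open>s\<close> approximates the square root of \<open>n\<close> well enough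
    that \<open>L\<close> may be replaced by \<open>N / 2\<close> even in terms of size
    \<open>n\<^sup>2 * N\<close>.\<close>
  have \<delta>: "0 \<le> N - 2 * L" "N - 2 * L \<le> 2 / real s"
  proof -
    have "N - 2 * L = ln (1 + t / (real s)\<^sup>2)"
    proof -
      have "2 * L = ln ((real s)\<^sup>2)"
        using s0 by (simp add: L_def ln_realpow)
      moreover have "1 + t / (real s)\<^sup>2 = real n / (real s)\<^sup>2"
        using s0 by (simp add: n_eq field_simps)
      ultimately show ?thesis
        using s0 n0 by (simp add: N_def ln_div)
    qed
    moreover have "0 \<le> t / (real s)\<^sup>2"
      using t by simp
    ultimately have "0 \<le> N - 2 * L" "N - 2 * L \<le> t / (real s)\<^sup>2"
      using ln_add_one_self_le_self by simp_all
    moreover have "t / (real s)\<^sup>2 \<le> 2 / real s"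
      using t s0 by (simp add: divide_simps power2_eq_square)
    ultimately show "0 \<le> N - 2 * L" "N - 2 * L \<le> 2 / real s"
      by linarith+
  qed
  \<comment> \<open>As \<open>n\<close> is at most \<open>2 * s * s\<close>, a relative error of
    order \<open>N / s\<close> in an \<open>n\<^sup>2\<close> term is admissible.\<close>
  have nsN: "(real n)\<^sup>2 * (N / real s) \<le> 2 * U"
  proof -
    have "real n / real s \<le> 2 * real s"
      using n_le s0 by (simp add: divide_simps)
    then have "(real n * N) * (real n / real s) \<le> (real n * N) * (2 * real s)"
      using N by (intro mult_left_mono) auto
    then show ?thesis
      by (simp add: U_def power2_eq_square mult_ac)
  qed
  have err_le: "\<bar>(real n)\<^sup>2 * (c * e)\<bar> \<le> 2 * U" if "\<bar>c\<bar> \<le> a" "\<bar>e\<bar> \<le> e'" "a * e' \<le> N / real s" for a c e e'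
  proof -
    have "\<bar>c * e\<bar> \<le> a * e'"
      unfolding abs_mult using that by (intro mult_mono) auto
    then have "(real n)\<^sup>2 * \<bar>c * e\<bar> \<le> (real n)\<^sup>2 * (N / real s)"
      using that by (intro mult_left_mono) auto
    with nsN show ?thesis
      by (simp add: abs_mult)
  qed

  have b1: "\<bar>A1\<bar> \<le> 4 * U"
  proof -
    have "A1 \<le> (\<Sum>b = 2..s. 4 * real n * N)"
      unfolding A1_def N_def using \<open>s \<le> n\<close> by (intro sum_mono S_small_base_le(1)) auto
    also have "\<dots> = real (s - 1) * (4 * real n * N)"
      by simp
    also have "\<dots> \<le> real s * (4 * real n * N)"
      using N by (intro mult_right_mono mult_nonneg_nonneg) auto
    finally have "A1 \<le> 4 * U"
      by (simp add: U_def mult_ac)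
    moreover have "0 \<le> A1"
      unfolding A1_def using \<open>s \<le> n\<close> by (intro sum_nonneg S_small_base_le(2)) auto
    ultimately show ?thesis by simp
  qed
  have b2: "\<bar>e4\<bar> \<le> 2 * U"
    using sum_ln_double_sum_approx[OF s(1,2)]
    unfolding e4_def U_def N_def L_def D_def H_def W_def by (simp only: mult.assoc)
  have e3: "\<bar>e3\<bar> \<le> 2 * N / real s"
    using sum_ln_over_pred_approx[OF s(1) \<open>s \<le> n\<close>] unfolding e3_def R_def N_def L_def .
  have "\<bar>real n * (real n - 1) * e3\<bar> \<le> (real n)\<^sup>2 * (2 * N / real s)"
    unfolding abs_mult using e3 n0 by (intro mult_mono) (auto simp: power2_eq_square abs_mult)
  also have "\<dots> = 2 * ((real n)\<^sup>2 * (N / real s))"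
    by simp
  finally have b3: "\<bar>real n * (real n - 1) * e3\<bar> \<le> 4 * U"
    using nsN by linarith
  have b4: "\<bar>(real n)\<^sup>2 * ((N / 2 - 3 / 4) * e1)\<bar> \<le> 2 * U"
  proof (rule err_le)
    show "\<bar>N / 2 - 3 / 4\<bar> \<le> N"
      using N by linarith
    show "\<bar>e1\<bar> \<le> 1 / real s"
      using harm_approx[of s] s(1) by (simp add: e1_def H_def L_def)
  qed simp
  have b5: "\<bar>(real n)\<^sup>2 * (1 * e2)\<bar> \<le> 2 * U"
  proof (rule err_le)
    show "\<bar>e2\<bar> \<le> L / real s"
      using sum_ln_over_self_approx[OF s(1)] by (simp add: e2_def W_def L_def)
    show "1 * (L / real s) \<le> N / real s"
      using LN s0 by (simp add: divide_right_mono)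
  qed simp
  \<comment> \<open>Remainder from replacing \<open>n * (n - 1)\<close> by \<open>n\<^sup>2\<close>
    in front of the main term of \<open>R\<close>.\<close>
  have b6: "\<bar>real n * (N\<^sup>2 - L\<^sup>2) / 2\<bar> \<le> U"
  proof -
    have "L\<^sup>2 \<le> N\<^sup>2"
      using L LN by (intro power_mono) auto
    moreover have "N\<^sup>2 \<le> 2 * (real s * N)"
      unfolding power2_eq_square mult.assoc[symmetric] using N N_le by (intro mult_right_mono) auto
    moreover have "N\<^sup>2 - L\<^sup>2 \<le> N\<^sup>2"
      by simp
    ultimately have "0 \<le> N\<^sup>2 - L\<^sup>2" "N\<^sup>2 - L\<^sup>2 \<le> 2 * (real s * N)"
      using order_trans by (simp, blast)
    then have "\<bar>(N\<^sup>2 - L\<^sup>2) / 2\<bar> \<le> real s * N"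
      by simp
    then have "real n * \<bar>(N\<^sup>2 - L\<^sup>2) / 2\<bar> \<le> real n * (real s * N)"
      by (intro mult_left_mono) auto
    then show ?thesis
      by (simp add: U_def abs_mult mult_ac)
  qed
  \<comment> \<open>Remainder from writing \<open>s\<^sup>2\<close> as \<open>n - t\<close> in the
    term \<open>2 * n * s\<^sup>2 * (L - 1)\<close>.\<close>
  have b7: "\<bar>2 * real n * t * (L - 1)\<bar> \<le> 4 * U"
  proof -
    have "\<bar>t * (L - 1)\<bar> \<le> 2 * real s * N"
      unfolding abs_mult using t L LN by (intro mult_mono) auto
    then have "2 * real n * \<bar>t * (L - 1)\<bar> \<le> 2 * real n * (2 * real s * N)"
      by (intro mult_left_mono) auto
    moreover have "\<bar>2 * real n * t * (L - 1)\<bar> = 2 * real n * \<bar>t * (L - 1)\<bar>"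
      by (simp only: abs_mult mult.assoc abs_of_nat abs_numeral)
    ultimately show ?thesis
      by (simp only: U_def)
  qed
  \<comment> \<open>Remainder from replacing \<open>s ^ 3 * (s + 1)\<close> by
    \<open>n\<^sup>2\<close>, using \<open>n\<^sup>2 - s ^ 4 = t * (n + s\<^sup>2)\<close>.\<close>
  have b8: "\<bar>(real s ^ 3 - t * (real n + (real s)\<^sup>2)) * (L / 2 - 1 / 4)\<bar> \<le> 5 * U"
  proof -
    have sn: "(real s)\<^sup>2 \<le> real n"
      using t n_eq by simp
    then have "real s ^ 3 \<le> real s * real n"
      by (simp add: power3_eq_cube power2_eq_square mult_left_mono mult.assoc)
    moreover have "t * (real n + (real s)\<^sup>2) \<le> (2 * real s) * (2 * real n)"
      using t sn by (intro mult_mono) auto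
    moreover have "0 \<le> real s ^ 3" "0 \<le> t * (real n + (real s)\<^sup>2)" "0 \<le> real s * real n"
      using t by simp_all
    ultimately have "\<bar>real s ^ 3 - t * (real n + (real s)\<^sup>2)\<bar> \<le> 5 * (real s * real n)"
      by linarith
    moreover have "\<bar>L / 2 - 1 / 4\<bar> \<le> N"
      using L LN by linarith
    ultimately have "\<bar>(real s ^ 3 - t * (real n + (real s)\<^sup>2)) * (L / 2 - 1 / 4)\<bar> \<le> 5 * (real s * real n) * N"
      unfolding abs_mult by (intro mult_mono) auto
    then show ?thesis
      by (simp add: U_def mult_ac)
  qed
  \<comment> \<open>What is left of the logarithmic main terms:
    \<open>N\<^sup>2 / 2 - N * L + 3 * L - 3 * N / 2\<close> factors as
    \<open>(N - 3) / 2 * (N - 2 * L)\<close>.\<close>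
  have b9: "\<bar>(real n)\<^sup>2 * (((N - 3) / 4) * (N - 2 * L))\<bar> \<le> 2 * U"
  proof (rule err_le)
    show "\<bar>(N - 3) / 4\<bar> \<le> N / 2"
      using N by (simp add: abs_le_iff field_simps)
    show "\<bar>N - 2 * L\<bar> \<le> 2 / real s"
      using \<delta> by simp
  qed simp

  have sum_bound: "\<bar>a1 - 2 * a2 + a3 - 2 * a4 + a5 - a6 - a7 - a8 + 2 * a9\<bar> \<le> 34 * U"
    if "\<bar>a1\<bar> \<le> 4 * U" "\<bar>a2\<bar> \<le> 2 * U" "\<bar>a3\<bar> \<le> 4 * U" "\<bar>a4\<bar> \<le> 2 * U" "\<bar>a5\<bar> \<le> 2 * U"
      "\<bar>a6\<bar> \<le> U" "\<bar>a7\<bar> \<le> 4 * U" "\<bar>a8\<bar> \<le> 5 * U" "\<bar>a9\<bar> \<le> 2 * U"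
    for a1 a2 a3 a4 a5 a6 a7 a8 a9
    using that unfolding abs_le_iff by linarith
  \<comment> \<open>The \<open>L\<^sup>2\<close> contributions of \<open>R\<close> and
    \<open>W\<close> cancel, and the constants \<open>-2\<close> and \<open>1 / 4\<close> combine to
    \<open>-7 / 4\<close>.\<close>
  have "A_bar n - ((3 / 2 - euler_mascheroni) * (real n)\<^sup>2 * N
        + (3 / 2 * euler_mascheroni + stieltjes_1 - 7 / 4) * (real n)\<^sup>2)
    = A1 - 2 * e4 + real n * (real n - 1) * e3 - 2 * ((real n)\<^sup>2 * ((N / 2 - 3 / 4) * e1))
      + (real n)\<^sup>2 * (1 * e2) - real n * (N\<^sup>2 - L\<^sup>2) / 2 - 2 * real n * t * (L - 1)
      - (real s ^ 3 - t * (real n + (real s)\<^sup>2)) * (L / 2 - 1 / 4)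
      + 2 * ((real n)\<^sup>2 * (((N - 3) / 4) * (N - 2 * L)))"
  proof -
    have A_bar: "A_bar n = A1 + (real n * (real n - 1) * R - 2 * D)"
      unfolding A1_def R_def D_def using s by (intro A_bar_split) auto
    have RHW: "R = (N\<^sup>2 - L\<^sup>2) / 2 + e3" "H = L + euler_mascheroni + e1" "W = L\<^sup>2 / 2 + stieltjes_1 + e2"
      by (simp_all add: e1_def e2_def e3_def)
    have D: "D = (real n)\<^sup>2 * ((N / 2 - 3 / 4) * H - W / 2)
         - real n * (real s)\<^sup>2 * (L - 1) + real s ^ 3 * (real s + 1) * (L / 4 - 1 / 8) + e4"
      by (simp add: e4_def)
    show ?thesis
      unfolding A_bar D RHW t_def
      by (simp add: algebra_simps power2_eq_square power3_eq_cube add_divide_distrib diff_divide_distrib)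
  qed
  also have "\<bar>\<dots>\<bar> \<le> 34 * U"
    by (rule sum_bound[OF b1 b2 b3 b4 b5 b6 b7 b8 b9])
  finally show ?thesis
    by (simp add: N_def U_def)
qed

theorem theorem3p2:
  shows "\<exists>C :: real. C > 0 \<and> ( \<forall>n :: nat. n \<ge> 2 \<longrightarrow>
    \<bar>A_bar n - ((3 / 2 - euler_mascheroni) * (real n)\<^sup>2 * ln (real n)
        + (3 / 2 * euler_mascheroni + stieltjes_1 - 7 / 4) * (real n)\<^sup>2)\<bar>
      \<le> C * (real n powr (3 / 2) * ln (real n)))"
proof -
  define E where "E n = \<bar>A_bar n - ((3 / 2 - euler_mascheroni) * (real n)\<^sup>2 * ln (real n)
        + (3 / 2 * euler_mascheroni + stieltjes_1 - 7 / 4) * (real n)\<^sup>2)\<bar>" for n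
  define h where "h n = real n powr (3 / 2) * ln (real n)" for n
  have h_pos: "h n > 0" if "n \<ge> 2" for n
    using that by (simp add: h_def)
  \<comment> \<open>The threshold 9 makes the integer part \<open>s\<close> of the square root at
    least 3.\<close>
  have large: "E n \<le> 34 * h n" if "n \<ge> 9" for n
  proof -
    define s where "s = nat \<lfloor>sqrt (real n)\<rfloor>"
    have s_le: "real s \<le> sqrt (real n)" and s_gt: "sqrt (real n) < real s + 1"
      unfolding s_def by (simp_all add: of_nat_nat)
    have "(real s)\<^sup>2 \<le> (sqrt (real n))\<^sup>2"
      using s_le by (intro power_mono) auto
    then have "real (s * s) \<le> real n"
      by (simp add: power2_eq_square)
    then have "s * s \<le> n"
      by (simp only: of_nat_le_iff)
    moreover have "real n < (real s + 1)\<^sup>2"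
      using s_gt real_less_rsqrt[of "real s + 1" "real n"]
      by (metis not_less real_le_lsqrt of_nat_0_le_iff add_nonneg_nonneg zero_le_one real_le_rsqrt)
    then have "real n < real ((s + 1) * (s + 1))"
      by (simp add: power2_eq_square algebra_simps)
    then have "n < (s + 1) * (s + 1)"
      by (simp only: of_nat_less_iff)
    moreover have "3 \<le> s"
      using that le_nat_floor[of 3 "sqrt (real n)"] real_le_rsqrt[of 3 "real n"] by (simp add: s_def)
    ultimately have "E n \<le> 34 * (real n * real s * ln (real n))"
      unfolding E_def by (intro A_bar_approx)
    also have "\<dots> \<le> 34 * (real n * sqrt (real n) * ln (real n))"
      using that s_le by (intro mult_left_mono mult_right_mono) auto
    also have "real n * sqrt (real n) = real n powr (3 / 2)"
      using that powr_add[of "real n" 1 "1 / 2"] by (simp add: powr_half_sqrt)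
    finally show ?thesis by (simp add: h_def)
  qed
  \<comment> \<open>The finitely many \<open>n\<close> below 9 are absorbed by adding their ratios
    \<open>E n / h n\<close>, which are nonnegative.\<close>
  define C where "C = 34 + (\<Sum>n = 2..<9. E n / h n)"
  have nonneg: "0 \<le> E n / h n" if "n \<in> {2..<9}" for n
    using that h_pos[of n] by (simp add: E_def)
  then have C_ge: "34 \<le> C"
    unfolding C_def using sum_nonneg[of "{2..<9}" "\<lambda>n. E n / h n"] by simp
  then have "C > 0"
    by simp
  moreover have "E n \<le> C * h n" if "n \<ge> 2" for n
  proof (cases "n \<ge> 9")
    case True
    have "34 * h n \<le> C * h n"
      using h_pos[OF that] C_ge by (intro mult_right_mono) simp_all
    with large[OF True] show ?thesis by linarith
  next
    case False
    then have "E n / h n \<le> (\<Sum>n = 2..<9. E n / h n)"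
      using that nonneg by (intro member_le_sum) auto
    then have "E n / h n \<le> C"
      by (simp add: C_def)
    then show ?thesis
      using h_pos[OF that] by (simp add: divide_simps)
  qed
  ultimately show ?thesis
    unfolding E_def h_def by blast
qed

end
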